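(* Let $n\ge 1$ and $r>0$. Suppose $f:\mathbb{R}^n\to\mathbb{R}$ is an admissible function satisfying the following three conditions: (1) $f(0)=\widehat f(0)>0$, (2) $f(x)\le 0$ for all $x\in\mathbb{R}^n$ with $|x|\ge r$, and (3) $\widehat f(t)\ge 0$ for all $t\in\mathbb{R}^n$. Then the center density of every sphere packing in $\mathbb{R}^n$ is bounded above by $(r/2)^n$.
   Context: Fourier transform: for $f\in L^1(\mathbb{R}^n)$, $\widehat f(t)=\int_{\mathbb{R}^n} f(x)e^{2\pi i\langle x,t\rangle}\,dx$. A function $f:\mathbb{R}^n\to\mathbb{R}$ is admissible if it is continuous and there are constants $\delta>0$ and $C>0$ such that $|f(x)|\le C(1+|x|)^{-n-\delta}$ and $|\widehat f(x)|\le C(1+|x|)^{-n-\delta}$ for all $x\in\mathbb{R}^n$. A sphere packing in $\mathbb{R}^n$ is a collection $\mathcal P$ of congruent closed balls (of positive radius) that do not intersect except along their boundaries. Its density $\Delta$ is the fraction of space covered by the balls, taken in general to be the upper density $$\Delta=\limsup_{r\to\infty}\ \sup_{p\in\mathbb{R}^n}\frac{\operatorname{vol}(B(p,r)\cap\mathcal P)}{\operatorname{vol}B(p,r)},$$ where $B(p,r)$ is the ball of radius $r$ centered at $p$ and $B(p,r)\cap\mathcal P$ denotes the part of $B(p,r)$ covered by the balls of $\mathcal P$. The center density $\delta$ of the packing is defined by $\Delta=\frac{\pi^{n/2}}{(n/2)!}\,\delta$ (the number of sphere centers per unit volume when the packing is scaled to use unit spheres), where $(n/2)!$ means $\Gamma(n/2+1)$.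 *)

theory Defs
  imports "HOL-Analysis.Analysis"
begin

text \<open>The Bochner integral returns 0 for non-integrable
  integrands, so the value is only meaningful for absolutely integrable \<open>f\<close>.\<close>

definition fourier :: "((real ^ 'n) \<Rightarrow> complex) \<Rightarrow> (real ^ 'n) \<Rightarrow> complex" where
  "fourier f t = (LINT x|lebesgue. f x * exp (2 * complex_of_real pi * \<i> * complex_of_real (x \<bullet> t)))"

definition admissible :: "((real ^ 'n) \<Rightarrow> real) \<Rightarrow> bool" where
  "admissible f \<longleftrightarrow> continuous_on UNIV f \<and>
     (\<exists>\<delta>>0. \<exists>C>0. \<forall>x.
        \<bar>f x\<bar> \<le> C * (1 + norm x) powr (- real CARD('n) - \<delta>) \<and>
        norm (fourier (\<lambda>y. complex_of_real (f y)) x) \<le> C * (1 + norm x) powr (- real CARD('n) - \<delta>))"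

text \<open>A packing is the set of its balls. Nothing is lost by not counting multiplicities: two
  coinciding balls of positive radius would meet in interior points.\<close>

definition sphere_packing :: "(real ^ 'n) set set \<Rightarrow> bool" where
  "sphere_packing P \<longleftrightarrow>
     (\<exists>\<rho>>0. \<forall>B\<in>P. \<exists>c. B = cball c \<rho>) \<and>
     (\<forall>A\<in>P. \<forall>B\<in>P. A \<noteq> B \<longrightarrow> A \<inter> B \<subseteq> frontier A \<inter> frontier B)"

text \<open>Extended reals serve only to have \<open>Limsup\<close> and \<open>SUP\<close> available without
  boundedness side conditions; the quotients lie between 0 and 1.\<close>

definition packing_density :: "(real ^ 'n) set set \<Rightarrow> ereal" where
  "packing_density P =
     Limsup at_top (\<lambda>r::real. SUP p. ereal (measure lebesgue (cball p r \<inter> \<Union>P) / measure lebesgue (cball p r)))"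

text \<open>The divisor is the volume of the unit ball, with \<open>(n/2)!\<close> read as \<open>\<Gamma>(n/2 + 1)\<close>.\<close>

definition center_density :: "(real ^ 'n) set set \<Rightarrow> ereal" where
  "center_density P =
     packing_density P / ereal (pi powr (real CARD('n) / 2) / Gamma (real CARD('n) / 2 + 1))"

end

theory Submission
  imports Defs "HOL-Probability.Characteristic_Functions"
begin

text \<open>
  The linear programming bound of Cohn and Elkies is usually derived from the Poisson summation
  formula for periodic packings. Here it is derived for arbitrary packings from positive
  definiteness alone.

  A continuous integrable bounded function \<open>f\<close> whose Fourier transform is nonnegative satisfies
  \<open>\<integral>\<integral> f (x - y) d\<mu> x d\<mu> y \<ge> 0\<close> for every difference \<open>\<mu>\<close> of two finite measures
  (\<open>mutual_energy_nonneg\<close>). If \<open>f\<close> is convolved with a narrow Gaussian, Fubini's theorem and the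
  Fourier transform of the Gaussian write it as the transform of a nonnegative integrable density,
  so that the double integral is the integral of this density against the squared modulus of the
  transform of \<open>\<mu>\<close>; then let the width tend to 0.

  Let \<open>X\<close> be a finite set of points in a ball \<open>B\<close> with mutual distances at least \<open>r\<close>. Apply this to
  the sum of the point masses on \<open>X\<close> minus \<open>c = card X / vol B\<close> times Lebesgue measure on \<open>B\<close>. Up to
  boundary effects the result is
  \<open>\<Sum> f (x - y) - 2 * c * card X * (\<integral> f) + c\<^sup>2 * vol B * (\<integral> f) \<ge> 0\<close>. The sum over pairs is
  at most \<open>card X * f 0\<close>, as \<open>f \<le> 0\<close> outside the ball of radius \<open>r\<close>. With \<open>f 0 = \<integral> f\<close> this
  says \<open>card X \<le> vol B\<close>, up to a factor tending to 1 as the radius of \<open>B\<close> grows, uniformly in the center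
  of \<open>B\<close> and in \<open>X\<close> (\<open>separated_points_count_asymptotic\<close>).

  A packing by balls of radius \<open>\<rho>\<close>, dilated by \<open>r / (2 * \<rho>)\<close>, has centers with mutual distances at
  least \<open>r\<close>. So the dilated packing has asymptotically at most one center per unit volume, and its
  balls have radius \<open>r / 2\<close>; the density is at most the volume of a ball of radius \<open>r / 2\<close>
  (\<open>packing_density_le\<close>), which is \<open>(r / 2) ^ n\<close> times the volume of the unit ball.
\<close>

section \<open>The Fourier transform of the Gaussian\<close>

lemma lborel_integral_affine:
  fixes h :: "'a::euclidean_space \<Rightarrow> real"
  assumes [measurable]: "h \<in> borel_measurable borel" and c: "c \<noteq> 0"
  shows "(LINT x|lborel. h x) = \<bar>c\<bar> ^ DIM('a) * (LINT x|lborel. h (t + c *\<^sub>R x))"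
  by (subst lborel_affine[OF c, of t]) (simp add: integral_density integral_distr)

lemma lborel_integrable_affine:
  fixes h :: "'a::euclidean_space \<Rightarrow> real"
  assumes h: "integrable lborel h" and c: "c \<noteq> 0"
  shows "integrable lborel (\<lambda>x. h (t + c *\<^sub>R x))"
proof -
  have [measurable]: "h \<in> borel_measurable borel"
    using h by auto
  have "integrable (density (distr lborel borel (\<lambda>x. t + c *\<^sub>R x)) (\<lambda>_. \<bar>c\<bar> ^ DIM('a))) h"
    using h by (subst (asm) lborel_affine[OF c, of t])
  with c show ?thesis
    by (simp add: integrable_density integrable_distr_eq)
qed

lemma
  fixes \<phi> :: "'a::euclidean_space \<Rightarrow> real \<Rightarrow> 'b::{real_normed_field,banach,second_countable_topology}"
  assumes \<phi>: "\<And>b. b \<in> Basis \<Longrightarrow> integrable lborel (\<phi> b)"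
  shows lborel_integrable_prod: "integrable lborel (\<lambda>x. \<Prod>b\<in>Basis. \<phi> b (x \<bullet> b))"
    and lborel_integral_prod:
      "(LINT x|lborel. (\<Prod>b\<in>Basis. \<phi> b (x \<bullet> b))) = (\<Prod>b\<in>Basis. LINT s|lborel. \<phi> b s)"
proof -
  interpret product_sigma_finite "\<lambda>_::'a. lborel :: real measure"
    by standard
  have \<phi>'[measurable]: "\<And>b. b \<in> Basis \<Longrightarrow> \<phi> b \<in> borel_measurable borel"
    using \<phi> by auto
  let ?g = "\<lambda>x::'a. \<Prod>b\<in>Basis. \<phi> b (x \<bullet> b)"
  have T[measurable]: "(\<lambda>y. \<Sum>b\<in>Basis. y b *\<^sub>R b) \<in> (\<Pi>\<^sub>M b\<in>Basis. lborel) \<rightarrow>\<^sub>M (borel::'a measure)"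
    by simp
  have g: "?g \<in> borel_measurable borel"
    by measurable
  have eq: "?g (\<Sum>b\<in>Basis. y b *\<^sub>R b) = (\<Prod>b\<in>Basis. \<phi> b (y b))" for y
    by (intro prod.cong) (simp_all)
  show "integrable lborel ?g"
    unfolding lborel_eq[where 'a='a] integrable_distr_eq[OF T g] eq
    by (intro product_integrable_prod \<phi>) auto
  show "integral\<^sup>L lborel ?g = (\<Prod>b\<in>Basis. LINT s|lborel. \<phi> b s)"
    unfolding lborel_eq[where 'a='a] integral_distr[OF T g] eq
    by (intro product_integral_prod \<phi>) auto
qed

lemma exp_norm_eq_prod:
  fixes x :: "'a::euclidean_space"
  shows "exp (- (norm x)\<^sup>2 / 2) = (\<Prod>b\<in>Basis. exp (- (x \<bullet> b)\<^sup>2 / 2))"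
proof -
  have "(norm x)\<^sup>2 = (\<Sum>b\<in>Basis. (x \<bullet> b)\<^sup>2)"
    unfolding power2_norm_eq_inner by (subst euclidean_inner) (simp add: power2_eq_square)
  then show ?thesis
    by (simp add: exp_sum[symmetric] sum_negf sum_divide_distrib)
qed

lemma integrable_gaussian_real: "integrable lborel (\<lambda>s::real. exp (- s\<^sup>2 / 2))"
proof -
  have "integrable lborel (\<lambda>s. sqrt (2 * pi) * std_normal_density s)"
    by (intro integrable_mult_right integrable_normal_density) simp
  then show ?thesis
    by (simp add: std_normal_density_def)
qed

lemma integral_gaussian_cis_real:
  fixes u :: real
  shows "(LINT s|lborel. complex_of_real (exp (- s\<^sup>2 / 2)) * cis (u * s))
     = complex_of_real (sqrt (2 * pi) * exp (- u\<^sup>2 / 2))"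
proof -
  have "complex_of_real (exp (- u\<^sup>2 / 2)) = (CLINT s|std_normal_distribution. iexp (u * s))"
    using char_std_normal_distribution by (simp add: char_def fun_eq_iff)
  also have "\<dots> = (CLINT s|lborel. std_normal_density s *\<^sub>R iexp (u * s))"
    by (subst integral_density) (auto simp: normal_density_nonneg)
  also have "\<dots> = (CLINT s|lborel. (exp (- s\<^sup>2 / 2) * cis (u * s)) / sqrt (2 * pi))"
    by (intro Bochner_Integration.integral_cong)
       (simp_all add: std_normal_density_def scaleR_conv_of_real cis_conv_exp exp_of_real[symmetric])
  finally show ?thesis
    by (simp add: divide_eq_eq mult.commute exp_of_real[symmetric])
qed

lemma integrable_gaussian:
  "integrable lborel (\<lambda>t::'a::euclidean_space. exp (- (norm t)\<^sup>2 / 2))"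
  unfolding exp_norm_eq_prod
  by (intro lborel_integrable_prod integrable_gaussian_real)

lemma integral_gaussian_cos:
  fixes u :: "'a::euclidean_space"
  shows "(LINT t|lborel. exp (- (norm t)\<^sup>2 / 2) * cos (u \<bullet> t))
     = sqrt (2 * pi) ^ DIM('a) * exp (- (norm u)\<^sup>2 / 2)"
proof -
  let ?\<phi> = "\<lambda>b::'a. \<lambda>s. complex_of_real (exp (- s\<^sup>2 / 2)) * cis ((u \<bullet> b) * s)"
  have int: "integrable lborel (?\<phi> b)" for b
    by (rule Bochner_Integration.integrable_bound[OF integrable_gaussian_real])
       (simp_all add: norm_mult cis_conv_exp)
  have prod: "(\<Prod>b\<in>Basis. ?\<phi> b (t \<bullet> b)) = complex_of_real (exp (- (norm t)\<^sup>2 / 2)) * cis (u \<bullet> t)" for t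
  proof -
    have "(\<Prod>b\<in>Basis. cis ((u \<bullet> b) * (t \<bullet> b))) = cis (\<Sum>b\<in>Basis. (u \<bullet> b) * (t \<bullet> b))"
      by (simp add: cis_conv_exp exp_sum sum_distrib_left)
    then show ?thesis
      by (simp only: exp_norm_eq_prod prod.distrib of_real_prod euclidean_inner[of u t])
  qed
  have "(LINT t|lborel. complex_of_real (exp (- (norm t)\<^sup>2 / 2)) * cis (u \<bullet> t))
      = (\<Prod>b\<in>Basis. complex_of_real (sqrt (2 * pi) * exp (- (u \<bullet> b)\<^sup>2 / 2)))"
    using lborel_integral_prod[of ?\<phi>, OF int] unfolding prod integral_gaussian_cis_real .
  also have "\<dots> = complex_of_real (sqrt (2 * pi) ^ DIM('a) * exp (- (norm u)\<^sup>2 / 2))"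
    by (simp only: exp_norm_eq_prod prod.distrib of_real_prod of_real_mult prod_constant of_real_power)
  finally have "Re (LINT t|lborel. complex_of_real (exp (- (norm t)\<^sup>2 / 2)) * cis (u \<bullet> t))
      = sqrt (2 * pi) ^ DIM('a) * exp (- (norm u)\<^sup>2 / 2)"
    by simp
  moreover have "integrable lborel (\<lambda>t. complex_of_real (exp (- (norm t)\<^sup>2 / 2)) * cis (u \<bullet> t))"
    using lborel_integrable_prod[of ?\<phi>, OF int] unfolding prod .
  ultimately show ?thesis
    using integral_Re[of lborel "\<lambda>t. complex_of_real (exp (- (norm t)\<^sup>2 / 2)) * cis (u \<bullet> t)"]
    by (simp only: Re_complex_of_real Im_complex_of_real times_complex.sel cis.sel mult_zero_left diff_zero)
qed

section \<open>Energies of finite measures\<close>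

text \<open>Measurability of the integrand is not needed: a non-integrable function has Bochner integral 0.\<close>

lemma abs_integral_le_const:
  fixes h :: "'a \<Rightarrow> real"
  assumes "finite_measure N" and B: "\<And>y. \<bar>h y\<bar> \<le> B"
  shows "\<bar>LINT y|N. h y\<bar> \<le> B * measure N (space N)"
proof -
  interpret finite_measure N by fact
  have "\<bar>LINT y|N. h y\<bar> \<le> (LINT y|N. \<bar>h y\<bar>)"
    by (rule integral_abs_bound)
  also have "\<dots> \<le> (LINT y|N. B)"
    by (rule integral_mono') (use B order.trans[OF abs_ge_zero B] in auto)
  finally show ?thesis
    by (simp add: mult.commute)
qed

lemma integrable_mult_bounded:
  fixes w h :: "'a \<Rightarrow> real"
  assumes w: "integrable M w" and [measurable]: "h \<in> borel_measurable M" and h: "\<And>t. \<bar>h t\<bar> \<le> B"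
  shows "integrable M (\<lambda>t. w t * h t)"
proof (rule Bochner_Integration.integrable_bound)
  show "integrable M (\<lambda>t. B * w t)"
    using w by simp
  show "(\<lambda>t. w t * h t) \<in> borel_measurable M"
    using w by measurable
  show "AE t in M. norm (w t * h t) \<le> norm (B * w t)"
  proof (intro AE_I2)
    fix t
    have "\<bar>w t\<bar> * \<bar>h t\<bar> \<le> \<bar>w t\<bar> * \<bar>B\<bar>"
      by (intro mult_left_mono order.trans[OF h abs_ge_self]) simp
    then show "norm (w t * h t) \<le> norm (B * w t)"
      by (simp add: abs_mult mult.commute)
  qed
qed

lemma integrable_pair_bounded_kernel:
  fixes u :: "'a \<Rightarrow> real" and w :: "'b \<Rightarrow> real" and k :: "'a \<Rightarrow> 'b \<Rightarrow> real"
  assumes "sigma_finite_measure M" "sigma_finite_measure N"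
    and u: "integrable M u" and w: "integrable N w"
    and k[measurable]: "(\<lambda>(x, t). k x t) \<in> borel_measurable (M \<Otimes>\<^sub>M N)"
    and bound: "\<And>x t. \<bar>k x t\<bar> \<le> 1"
  shows "integrable (M \<Otimes>\<^sub>M N) (\<lambda>(x, t). u x * (w t * k x t))"
proof -
  interpret M: sigma_finite_measure M by fact
  interpret N: sigma_finite_measure N by fact
  interpret pair_sigma_finite M N ..
  have [measurable]: "u \<in> borel_measurable M" "w \<in> borel_measurable N"
    using u w by auto
  have "integrable (M \<Otimes>\<^sub>M N) (\<lambda>(x, t). u x * w t)"
    using u w by (intro Fubini_integrable) (auto simp: abs_mult)
  then show ?thesis
  proof (rule Bochner_Integration.integrable_bound)
    show "AE z in M \<Otimes>\<^sub>M N. norm (case z of (x, t) \<Rightarrow> u x * (w t * k x t))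
        \<le> norm (case z of (x, t) \<Rightarrow> u x * w t)"
    proof (intro AE_I2, clarify)
      fix x t
      have "\<bar>u x * w t\<bar> * \<bar>k x t\<bar> \<le> \<bar>u x * w t\<bar> * 1"
        by (intro mult_left_mono bound) simp
      then show "norm (u x * (w t * k x t)) \<le> norm (u x * w t)"
        by (simp add: abs_mult mult.assoc)
    qed
  qed measurable
qed

text \<open>The form of Fubini's theorem used throughout: a bounded jointly measurable kernel against
  an integrable function of each variable.\<close>

lemma integral_swap_bounded_kernel:
  fixes u :: "'a \<Rightarrow> real" and w :: "'b \<Rightarrow> real" and k :: "'a \<Rightarrow> 'b \<Rightarrow> real"
  assumes "sigma_finite_measure M" "sigma_finite_measure N"
    and u: "integrable M u" and w: "integrable N w"
    and k: "(\<lambda>(x, t). k x t) \<in> borel_measurable (M \<Otimes>\<^sub>M N)"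
    and bound: "\<And>x t. \<bar>k x t\<bar> \<le> 1"
  shows "(LINT x|M. u x * (LINT t|N. w t * k x t)) = (LINT t|N. w t * (LINT x|M. u x * k x t))"
proof -
  interpret M: sigma_finite_measure M by fact
  interpret N: sigma_finite_measure N by fact
  interpret pair_sigma_finite M N ..
  have "(LINT t|N. (LINT x|M. u x * (w t * k x t))) = (LINT x|M. (LINT t|N. u x * (w t * k x t)))"
    using integrable_pair_bounded_kernel[OF assms] by (rule Fubini_integral)
  moreover have "(LINT x|M. u x * (w t * k x t)) = w t * (LINT x|M. u x * k x t)" for t
    by (subst mult.left_commute) (rule integral_mult_right_zero)
  ultimately show ?thesis
    by simp
qed

text \<open>The energy \<open>\<integral>\<integral> f (x - y) dN y dM x\<close> of two measures with respect to the kernel \<open>f\<close>. The order of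
  \<open>M\<close> and \<open>N\<close> matters unless \<open>f\<close> is even.\<close>

definition mutual_energy ::
    "('a::euclidean_space \<Rightarrow> real) \<Rightarrow> 'a measure \<Rightarrow> 'a measure \<Rightarrow> real" where
  "mutual_energy f M N = (LINT x|M. (LINT y|N. f (x - y)))"

text \<open>By the addition theorem for \<open>cos (\<kappa> * ((x - y) \<bullet> t))\<close>, the energy of a cosine transform is the
  integral of the density against a sum of products of cosine and sine transforms of the two
  measures. The frequency scale \<open>\<kappa>\<close> avoids a substitution in the mollification below.\<close>

lemma mutual_energy_cosine_transform:
  fixes w :: "'a::euclidean_space \<Rightarrow> real" and M N :: "'a measure" and \<kappa> :: real
  assumes "finite_measure M" "finite_measure N"
    and sM[measurable_cong]: "sets M = sets borel" and sN[measurable_cong]: "sets N = sets borel"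
    and w: "integrable lborel w"
  defines "F \<equiv> \<lambda>x. LINT t|lborel. w t * cos (\<kappa> * (x \<bullet> t))"
  shows "has_bochner_integral lborel (\<lambda>t. w t * ((LINT x|M. cos (\<kappa> * (x \<bullet> t))) * (LINT y|N. cos (\<kappa> * (y \<bullet> t)))
            + (LINT x|M. sin (\<kappa> * (x \<bullet> t))) * (LINT y|N. sin (\<kappa> * (y \<bullet> t)))))
     (mutual_energy F M N)" (is "has_bochner_integral _ ?rhs _")
proof -
  interpret M: finite_measure M by fact
  interpret N: finite_measure N by fact
  have sf: "sigma_finite_measure M" "sigma_finite_measure N" "sigma_finite_measure (lborel :: 'a measure)"
    by unfold_locales
  have [measurable]: "w \<in> borel_measurable borel"
    using w by auto
  define c where "c P t = (LINT y|P. cos (\<kappa> * (y \<bullet> t)))" for P :: "'a measure" and t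
  define s where "s P t = (LINT y|P. sin (\<kappa> * (y \<bullet> t)))" for P :: "'a measure" and t
  have int_trig: "integrable P (\<lambda>y. cos (\<kappa> * (y \<bullet> t)))" "integrable P (\<lambda>y. sin (\<kappa> * (y \<bullet> t)))"
    if "finite_measure P" "sets P = sets borel" for P and t :: 'a
  proof -
    interpret P: finite_measure P by fact
    note that(2)[measurable_cong]
    show "integrable P (\<lambda>y. cos (\<kappa> * (y \<bullet> t)))" "integrable P (\<lambda>y. sin (\<kappa> * (y \<bullet> t)))"
      by (auto intro!: P.integrable_const_bound[where B=1])
  qed
  have meas[measurable]: "c P \<in> borel_measurable borel" "s P \<in> borel_measurable borel"
    if "sigma_finite_measure P" "sets P = sets borel" for P
  proof -
    interpret P: sigma_finite_measure P by fact
    note that(2)[measurable_cong]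
    show "c P \<in> borel_measurable borel" "s P \<in> borel_measurable borel"
      unfolding c_def s_def by measurable
  qed
  have bd: "\<bar>c P t\<bar> \<le> measure P (space P)" "\<bar>s P t\<bar> \<le> measure P (space P)"
    if "finite_measure P" "sets P = sets borel" for P t
    unfolding c_def s_def
    using abs_integral_le_const[OF that(1), of _ 1] by force+
  have [measurable]: "c M \<in> borel_measurable borel" "s M \<in> borel_measurable borel"
      "c N \<in> borel_measurable borel" "s N \<in> borel_measurable borel"
    using sf sM sN by (auto intro: meas)
  have int_c: "integrable lborel (\<lambda>t. w t * c N t)" and int_s: "integrable lborel (\<lambda>t. w t * s N t)"
    by (rule integrable_mult_bounded[OF w], measurable, rule bd, fact, fact)+
  have inner: "(LINT y|N. F (x - y)) =
      (LINT t|lborel. (w t * c N t) * cos (\<kappa> * (x \<bullet> t))) + (LINT t|lborel. (w t * s N t) * sin (\<kappa> * (x \<bullet> t)))" for x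
  proof -
    have "(LINT y|N. F (x - y)) = (LINT y|N. 1 * (LINT t|lborel. w t * cos (\<kappa> * ((x - y) \<bullet> t))))"
      by (simp add: F_def)
    also have "\<dots> = (LINT t|lborel. w t * (LINT y|N. 1 * cos (\<kappa> * ((x - y) \<bullet> t))))"
      by (rule integral_swap_bounded_kernel) (use sf w in auto)
    also have "\<dots> = (LINT t|lborel. (w t * c N t) * cos (\<kappa> * (x \<bullet> t)) + (w t * s N t) * sin (\<kappa> * (x \<bullet> t)))"
    proof (intro Bochner_Integration.integral_cong refl)
      fix t
      have "(LINT y|N. 1 * cos (\<kappa> * ((x - y) \<bullet> t))) =
          (LINT y|N. cos (\<kappa> * (x \<bullet> t)) * cos (\<kappa> * (y \<bullet> t)) + sin (\<kappa> * (x \<bullet> t)) * sin (\<kappa> * (y \<bullet> t)))"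
        by (simp add: inner_diff_left right_diff_distrib cos_diff)
      also have "\<dots> = cos (\<kappa> * (x \<bullet> t)) * c N t + sin (\<kappa> * (x \<bullet> t)) * s N t"
        using int_trig[OF \<open>finite_measure N\<close> sN, of t] by (simp add: c_def s_def)
      finally show "w t * (LINT y|N. 1 * cos (\<kappa> * ((x - y) \<bullet> t))) =
          (w t * c N t) * cos (\<kappa> * (x \<bullet> t)) + (w t * s N t) * sin (\<kappa> * (x \<bullet> t))"
        by (simp add: algebra_simps)
    qed
    also have "\<dots> = (LINT t|lborel. (w t * c N t) * cos (\<kappa> * (x \<bullet> t)))
        + (LINT t|lborel. (w t * s N t) * sin (\<kappa> * (x \<bullet> t)))"
      by (intro Bochner_Integration.integral_add integrable_mult_bounded[where B=1] int_c int_s) auto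
    finally show ?thesis .
  qed
  have meas_inner: "integrable M (\<lambda>x. LINT t|lborel. (w t * c N t) * cos (\<kappa> * (x \<bullet> t)))"
     "integrable M (\<lambda>x. LINT t|lborel. (w t * s N t) * sin (\<kappa> * (x \<bullet> t)))"
  proof -
    interpret pair_sigma_finite M "lborel :: 'a measure"
      by unfold_locales
    have "integrable (M \<Otimes>\<^sub>M lborel) (\<lambda>(x, t). 1 * ((w t * c N t) * cos (\<kappa> * (x \<bullet> t))))"
      by (rule integrable_pair_bounded_kernel) (use sf int_c in auto)
    from integrable_fst[OF this]
    show "integrable M (\<lambda>x. LINT t|lborel. (w t * c N t) * cos (\<kappa> * (x \<bullet> t)))" by simp
    have "integrable (M \<Otimes>\<^sub>M lborel) (\<lambda>(x, t). 1 * ((w t * s N t) * sin (\<kappa> * (x \<bullet> t))))"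
      by (rule integrable_pair_bounded_kernel) (use sf int_s in auto)
    from integrable_fst[OF this]
    show "integrable M (\<lambda>x. LINT t|lborel. (w t * s N t) * sin (\<kappa> * (x \<bullet> t)))" by simp
  qed
  have "mutual_energy F M N = (LINT x|M. 1 * (LINT t|lborel. (w t * c N t) * cos (\<kappa> * (x \<bullet> t))))
      + (LINT x|M. 1 * (LINT t|lborel. (w t * s N t) * sin (\<kappa> * (x \<bullet> t))))"
    unfolding mutual_energy_def inner using meas_inner by simp
  also have "(LINT x|M. 1 * (LINT t|lborel. (w t * c N t) * cos (\<kappa> * (x \<bullet> t))))
      = (LINT t|lborel. (w t * c N t) * (LINT x|M. 1 * cos (\<kappa> * (x \<bullet> t))))"
    by (rule integral_swap_bounded_kernel) (use sf int_c in auto)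
  also have "(LINT x|M. 1 * (LINT t|lborel. (w t * s N t) * sin (\<kappa> * (x \<bullet> t))))
      = (LINT t|lborel. (w t * s N t) * (LINT x|M. 1 * sin (\<kappa> * (x \<bullet> t))))"
    by (rule integral_swap_bounded_kernel) (use sf int_s in auto)
  finally have eq: "mutual_energy F M N
      = (LINT t|lborel. (w t * c N t) * c M t) + (LINT t|lborel. (w t * s N t) * s M t)"
    by (simp add: c_def s_def)
  have i: "integrable lborel (\<lambda>t. (w t * c N t) * c M t)" "integrable lborel (\<lambda>t. (w t * s N t) * s M t)"
    by (rule integrable_mult_bounded, rule int_c int_s, measurable, rule bd, fact, fact)+
  have rhs: "?rhs = (\<lambda>t. (w t * c N t) * c M t + (w t * s N t) * s M t)"
    by (simp add: c_def s_def algebra_simps)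
  show ?thesis
    unfolding rhs eq using i by (simp add: has_bochner_integral_iff)
qed

text \<open>For a nonnegative density the quadratic form at the signed measure \<open>M - N\<close> becomes the
  integral of a sum of two squares.\<close>

lemma cosine_transform_energy_nonneg:
  fixes w :: "'a::euclidean_space \<Rightarrow> real" and M N :: "'a measure" and \<kappa> :: real
  assumes M: "finite_measure M" "sets M = sets borel" and N: "finite_measure N" "sets N = sets borel"
    and w: "integrable lborel w" and nonneg: "\<And>t. 0 \<le> w t"
  defines "F \<equiv> \<lambda>x. LINT t|lborel. w t * cos (\<kappa> * (x \<bullet> t))"
  shows "0 \<le> mutual_energy F M M - mutual_energy F M N - mutual_energy F N M + mutual_energy F N N"
proof -
  define c where "c P t = (LINT y|P. cos (\<kappa> * (y \<bullet> t)))" for P :: "'a measure" and t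
  define s where "s P t = (LINT y|P. sin (\<kappa> * (y \<bullet> t)))" for P :: "'a measure" and t
  note energy = mutual_energy_cosine_transform[where w=w and \<kappa>=\<kappa>, OF _ _ _ _ w, folded F_def, folded c_def s_def]
  note I = energy[THEN integrable.intros] and E = energy[THEN has_bochner_integral_integral_eq, symmetric]
  have "0 \<le> (LINT t|lborel. w t * ((c M t - c N t)\<^sup>2 + (s M t - s N t)\<^sup>2))"
    using nonneg by (intro Bochner_Integration.integral_nonneg) auto
  also have "\<dots> = (LINT t|lborel. w t * (c M t * c M t + s M t * s M t) - w t * (c M t * c N t + s M t * s N t)
      - w t * (c N t * c M t + s N t * s M t) + w t * (c N t * c N t + s N t * s N t))"
    by (intro Bochner_Integration.integral_cong) (auto simp: power2_eq_square algebra_simps)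
  also have "\<dots> = mutual_energy F M M - mutual_energy F M N - mutual_energy F N M + mutual_energy F N N"
    using I[OF M(1) M(1) M(2) M(2)] I[OF M(1) N(1) M(2) N(2)] I[OF N(1) M(1) N(2) M(2)] I[OF N(1) N(1) N(2) N(2)]
    by (simp add: E[OF M(1) M(1) M(2) M(2)] E[OF M(1) N(1) M(2) N(2)] E[OF N(1) M(1) N(2) M(2)] E[OF N(1) N(1) N(2) N(2)])
  finally show ?thesis .
qed

lemma mutual_energy_LIMSEQ:
  fixes F :: "nat \<Rightarrow> 'a::euclidean_space \<Rightarrow> real"
  assumes "finite_measure M" "finite_measure N"
    and sM[measurable_cong]: "sets M = sets borel" and sN[measurable_cong]: "sets N = sets borel"
    and F[measurable]: "\<And>k. F k \<in> borel_measurable borel"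
    and bound: "\<And>k x. \<bar>F k x\<bar> \<le> B"
    and lim: "\<And>x. (\<lambda>k. F k x) \<longlonglongrightarrow> f x"
  shows "(\<lambda>k. mutual_energy (F k) M N) \<longlonglongrightarrow> mutual_energy f M N"
proof -
  interpret M: finite_measure M by fact
  interpret N: finite_measure N by fact
  have [measurable]: "f \<in> borel_measurable borel"
    by (rule borel_measurable_LIMSEQ_real[OF lim F])
  show ?thesis
    unfolding mutual_energy_def
  proof (rule integral_dominated_convergence[where w="\<lambda>_. \<bar>B\<bar> * measure N (space N)"])
    show "AE x in M. (\<lambda>k. LINT y|N. F k (x - y)) \<longlonglongrightarrow> (LINT y|N. f (x - y))"
      using bound order.trans[OF bound abs_ge_self]
      by (intro AE_I2 integral_dominated_convergence[where w="\<lambda>_. \<bar>B\<bar>"]) (auto simp: lim)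
    show "AE x in M. norm (LINT y|N. F k (x - y)) \<le> \<bar>B\<bar> * measure N (space N)" for k
    proof (intro AE_I2)
      fix x
      show "norm (LINT y|N. F k (x - y)) \<le> \<bar>B\<bar> * measure N (space N)"
        unfolding real_norm_def
        by (rule abs_integral_le_const[OF \<open>finite_measure N\<close>]) (rule order.trans[OF bound abs_ge_self])
    qed
  qed measurable
qed

section \<open>Positive definiteness from a nonnegative Fourier transform\<close>

text \<open>Convolving with a Gaussian and using that the Gaussian is its own transform exhibits the
  mollified function as the transform of an explicit integrable density, with no inversion theorem
  for \<open>f\<close> itself. The vanishing of the sine transform removes the imaginary part of that formula.\<close>

lemma gaussian_mollification_eq_cosine_transform:
  fixes f :: "'a::euclidean_space \<Rightarrow> real" and \<kappa> :: real
  assumes f: "integrable lborel f" and \<kappa>: "\<kappa> > 0"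
    and sine: "\<And>s. (LINT z|lborel. f z * sin (z \<bullet> s)) = 0"
  shows "(LINT u|lborel. f (x - u /\<^sub>R \<kappa>) * exp (- (norm u)\<^sup>2 / 2)) =
    (LINT t|lborel. (\<kappa> ^ DIM('a) / sqrt (2 * pi) ^ DIM('a) * exp (- (norm t)\<^sup>2 / 2)
        * (LINT z|lborel. f z * cos (\<kappa> * (z \<bullet> t)))) * cos (\<kappa> * (x \<bullet> t)))"
proof -
  let ?g = "\<lambda>t::'a. exp (- (norm t)\<^sup>2 / 2)" and ?K = "sqrt (2 * pi) ^ DIM('a)"
  have sf: "sigma_finite_measure (lborel :: 'a measure)"
    by unfold_locales
  have [measurable]: "f \<in> borel_measurable borel"
    using f by auto
  have "(LINT z|lborel. f z * ?g (\<kappa> *\<^sub>R (x - z)))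
      = (1 / \<kappa>) ^ DIM('a) * (LINT u|lborel. f (x - u /\<^sub>R \<kappa>) * ?g u)"
    (* substitute z = x - u / kappa *)
    using \<kappa> by (subst lborel_integral_affine[where c="- (1 / \<kappa>)" and t=x]) (simp_all add: inverse_eq_divide)
  then have "(LINT u|lborel. f (x - u /\<^sub>R \<kappa>) * ?g u)
      = \<kappa> ^ DIM('a) * (LINT z|lborel. f z * ?g (\<kappa> *\<^sub>R (x - z)))"
    using \<kappa> by (simp add: power_divide)
  also have "(LINT z|lborel. f z * ?g (\<kappa> *\<^sub>R (x - z)))
      = (LINT z|lborel. f z * (LINT t|lborel. ?g t * cos (\<kappa> * ((x - z) \<bullet> t))) / ?K)"
  proof (intro Bochner_Integration.integral_cong refl)
    fix z
    have "(LINT t|lborel. ?g t * cos (\<kappa> * ((x - z) \<bullet> t))) = ?K * ?g (\<kappa> *\<^sub>R (x - z))"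
      using integral_gaussian_cos[of "\<kappa> *\<^sub>R (x - z)"] unfolding inner_scaleR_left .
    then show "f z * ?g (\<kappa> *\<^sub>R (x - z)) = f z * (LINT t|lborel. ?g t * cos (\<kappa> * ((x - z) \<bullet> t))) / ?K"
      by simp
  qed
  also have "\<dots> = (LINT z|lborel. f z * (LINT t|lborel. ?g t * cos (\<kappa> * ((x - z) \<bullet> t)))) / ?K"
    by simp
  also have "(LINT z|lborel. f z * (LINT t|lborel. ?g t * cos (\<kappa> * ((x - z) \<bullet> t))))
      = (LINT t|lborel. ?g t * (LINT z|lborel. f z * cos (\<kappa> * ((x - z) \<bullet> t))))"
    by (rule integral_swap_bounded_kernel) (use sf f integrable_gaussian in auto)
  also have "\<dots> = (LINT t|lborel. ?g t * ((LINT z|lborel. f z * cos (\<kappa> * (z \<bullet> t))) * cos (\<kappa> * (x \<bullet> t))))"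
  proof (intro Bochner_Integration.integral_cong refl arg_cong2[where f="(*)"])
    fix t
    have "(LINT z|lborel. f z * cos (\<kappa> * ((x - z) \<bullet> t)))
        = (LINT z|lborel. (f z * cos (\<kappa> * (z \<bullet> t))) * cos (\<kappa> * (x \<bullet> t))
            + (f z * sin (\<kappa> * (z \<bullet> t))) * sin (\<kappa> * (x \<bullet> t)))"
      by (simp add: inner_diff_left right_diff_distrib cos_diff algebra_simps)
    also have "\<dots> = (LINT z|lborel. f z * cos (\<kappa> * (z \<bullet> t))) * cos (\<kappa> * (x \<bullet> t))
        + (LINT z|lborel. f z * sin (\<kappa> * (z \<bullet> t))) * sin (\<kappa> * (x \<bullet> t))"
      by (subst Bochner_Integration.integral_add)
         (auto intro!: integrable_mult_left integrable_mult_bounded[OF f, where B=1])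
    also have "(LINT z|lborel. f z * sin (\<kappa> * (z \<bullet> t))) = 0"
      using sine[of "\<kappa> *\<^sub>R t"] by simp
    finally show "(LINT z|lborel. f z * cos (\<kappa> * ((x - z) \<bullet> t)))
        = (LINT z|lborel. f z * cos (\<kappa> * (z \<bullet> t))) * cos (\<kappa> * (x \<bullet> t))" by simp
  qed
  also have "\<kappa> ^ DIM('a) * (\<dots> / ?K) = (LINT t|lborel. \<kappa> ^ DIM('a) / ?K * (?g t *
      ((LINT z|lborel. f z * cos (\<kappa> * (z \<bullet> t))) * cos (\<kappa> * (x \<bullet> t)))))"
    unfolding integral_mult_right_zero by simp
  also have "\<dots> = (LINT t|lborel. (\<kappa> ^ DIM('a) / ?K * ?g t
        * (LINT z|lborel. f z * cos (\<kappa> * (z \<bullet> t)))) * cos (\<kappa> * (x \<bullet> t)))"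
    by (simp only: mult.assoc)
  finally show ?thesis .
qed

text \<open>A bounded continuous integrable function with nonnegative Fourier transform is positive
  definite on differences of finite measures: its mollifications are, and they converge to it
  boundedly and pointwise.\<close>

lemma mutual_energy_nonneg:
  fixes f :: "'a::euclidean_space \<Rightarrow> real" and M N :: "'a measure"
  assumes cont: "continuous_on UNIV f" and f: "integrable lborel f" and bound: "\<And>x. \<bar>f x\<bar> \<le> B"
    and cosine: "\<And>s. 0 \<le> (LINT z|lborel. f z * cos (z \<bullet> s))"
    and sine: "\<And>s. (LINT z|lborel. f z * sin (z \<bullet> s)) = 0"
    and M: "finite_measure M" "sets M = sets borel" and N: "finite_measure N" "sets N = sets borel"
  shows "0 \<le> mutual_energy f M M - mutual_energy f M N - mutual_energy f N M + mutual_energy f N N"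
proof -
  let ?g = "\<lambda>t::'a. exp (- (norm t)\<^sup>2 / 2)" and ?K = "sqrt (2 * pi) ^ DIM('a)"
  have [measurable]: "f \<in> borel_measurable borel"
    using cont by (rule borel_measurable_continuous_onI)
  define F where "F k x = (LINT u|lborel. f (x - u /\<^sub>R real (Suc k)) * ?g u) / ?K" for k x
  have K: "?K > 0" by simp
  have K_eq: "(LINT u|lborel. ?g u) = ?K"
    using integral_gaussian_cos[of "0::'a"] by simp
  have F_meas[measurable]: "F k \<in> borel_measurable borel" for k
    unfolding F_def by measurable
  have F_bound: "\<bar>F k x\<bar> \<le> B" for k x
  proof -
    have "\<bar>LINT u|lborel. f (x - u /\<^sub>R real (Suc k)) * ?g u\<bar>
        \<le> (LINT u|lborel. \<bar>f (x - u /\<^sub>R real (Suc k)) * ?g u\<bar>)"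
      by (rule integral_abs_bound)
    also have "\<dots> \<le> (LINT u|lborel. B * ?g u)"
      using bound integrable_gaussian order.trans[OF abs_ge_zero bound]
      by (intro integral_mono') (auto simp: abs_mult intro!: mult_right_mono)
    also have "\<dots> = B * ?K"
      using K_eq by simp
    finally show ?thesis
      using K by (simp add: F_def divide_le_eq)
  qed
  have F_lim: "(\<lambda>k. F k x) \<longlonglongrightarrow> f x" for x
  proof -
    have "(\<lambda>k. LINT u|lborel. f (x - u /\<^sub>R real (Suc k)) * ?g u) \<longlonglongrightarrow> (LINT u|lborel. f x * ?g u)"
    proof (rule integral_dominated_convergence[where w="\<lambda>u. B * ?g u"])
      show "integrable lborel (\<lambda>u. B * ?g u)"
        using integrable_gaussian by (rule integrable_mult_right)
      show "AE u in lborel. (\<lambda>k. f (x - u /\<^sub>R real (Suc k)) * ?g u) \<longlonglongrightarrow> f x * ?g u"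
      proof (intro AE_I2 tendsto_mult tendsto_const)
        fix u
        have "(\<lambda>k. x - inverse (real (Suc k)) *\<^sub>R u) \<longlonglongrightarrow> x - 0 *\<^sub>R u"
          by (intro tendsto_intros LIMSEQ_inverse_real_of_nat)
        moreover have "isCont f x"
          using cont by (simp add: continuous_on_eq_continuous_at)
        ultimately show "(\<lambda>k. f (x - u /\<^sub>R real (Suc k))) \<longlonglongrightarrow> f x"
          by (intro isCont_tendsto_compose[of x f]) simp_all
      qed
      show "AE u in lborel. norm (f (x - u /\<^sub>R real (Suc k)) * ?g u) \<le> B * ?g u" for k
        using bound by (auto simp: abs_mult intro!: mult_right_mono)
    qed measurable
    then have "(\<lambda>k. F k x) \<longlonglongrightarrow> (LINT u|lborel. f x * ?g u) / ?K"
      unfolding F_def by (intro tendsto_divide tendsto_const) (use K in auto)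
    then show ?thesis
      using K K_eq by simp
  qed
  have nonneg: "0 \<le> mutual_energy (F k) M M - mutual_energy (F k) M N
      - mutual_energy (F k) N M + mutual_energy (F k) N N" for k
  proof -
    define \<kappa> where "\<kappa> = real (Suc k)"
    define w where "w t = 1 / ?K * (\<kappa> ^ DIM('a) / ?K * ?g t * (LINT z|lborel. f z * cos (\<kappa> * (z \<bullet> t))))" for t
    have \<kappa>: "\<kappa> > 0" by (simp add: \<kappa>_def)
    have F_eq: "F k = (\<lambda>x. LINT t|lborel. w t * cos (\<kappa> * (x \<bullet> t)))"
      unfolding F_def w_def mult.assoc[of "1 / ?K"] integral_mult_right_zero
      using gaussian_mollification_eq_cosine_transform[OF f \<kappa> sine]
      by (simp add: \<kappa>_def fun_eq_iff)
    have "integrable lborel (\<lambda>t. ?g t * (LINT z|lborel. f z * cos (\<kappa> * (z \<bullet> t))))"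
    proof (rule integrable_mult_bounded[OF integrable_gaussian])
      fix t :: 'a
      have "\<bar>LINT z|lborel. f z * cos (\<kappa> * (z \<bullet> t))\<bar> \<le> (LINT z|lborel. \<bar>f z * cos (\<kappa> * (z \<bullet> t))\<bar>)"
        by (rule integral_abs_bound)
      also have "\<dots> \<le> (LINT z|lborel. \<bar>f z\<bar>)"
        using f by (intro integral_mono') (auto simp: abs_mult intro!: mult_left_le)
      finally show "\<bar>LINT z|lborel. f z * cos (\<kappa> * (z \<bullet> t))\<bar> \<le> (LINT z|lborel. \<bar>f z\<bar>)" .
    qed measurable
    then have "integrable lborel (\<lambda>t. (1 / ?K * (\<kappa> ^ DIM('a) / ?K)) * (?g t * (LINT z|lborel. f z * cos (\<kappa> * (z \<bullet> t)))))"
      by (rule integrable_mult_right)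
    then have w: "integrable lborel w"
      unfolding w_def mult.assoc .
    have "0 \<le> w t" for t
      using K \<kappa> cosine[of "\<kappa> *\<^sub>R t"] unfolding w_def by (intro mult_nonneg_nonneg) auto
    from cosine_transform_energy_nonneg[OF M N w this] show ?thesis
      unfolding F_eq .
  qed
  have "(\<lambda>k. mutual_energy (F k) M M - mutual_energy (F k) M N
      - mutual_energy (F k) N M + mutual_energy (F k) N N)
    \<longlonglongrightarrow> mutual_energy f M M - mutual_energy f M N - mutual_energy f N M + mutual_energy f N N"
    by (intro tendsto_add tendsto_diff mutual_energy_LIMSEQ[where B=B] M N F_meas F_bound F_lim)
  then show ?thesis
    by (rule LIMSEQ_le_const) (use nonneg in blast)
qed

section \<open>Counting separated points in a ball\<close>

text \<open>The image of the counting measure of \<open>X\<close> serves as the sum of the unit point masses on \<open>X\<close>,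
  with the Borel sets as its \<open>\<sigma>\<close>-algebra.\<close>

lemma integral_distr_count_space:
  fixes h :: "'a::topological_space \<Rightarrow> real"
  assumes "finite X" and h: "h \<in> borel_measurable borel"
  shows "(LINT x|distr (count_space X) borel (\<lambda>x. x). h x) = (\<Sum>x\<in>X. h x)"
  using assms by (subst integral_distr) (auto simp: lebesgue_integral_count_space_finite)

lemma integral_density_indicator:
  fixes h :: "'a::euclidean_space \<Rightarrow> real"
  assumes "0 \<le> c" "B \<in> sets borel" "h \<in> borel_measurable borel"
  shows "(LINT x|density lborel (\<lambda>y. ennreal (c * indicator B y)). h x) = c * (LINT y|lborel. indicator B y * h y)"
  using assms by (subst integral_density) (auto simp: mult.assoc)

lemma integrable_indicator_mult:
  fixes f :: "'a \<Rightarrow> real"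
  assumes "integrable M f" "A \<in> sets M"
  shows "integrable M (\<lambda>x. indicator A x * f x)"
  using integrable_mult_indicator[OF assms(2,1)] by simp

lemma abs_integral_indicator_le:
  fixes f :: "'a \<Rightarrow> real"
  assumes f: "integrable M f" and A: "A \<in> sets M"
  shows "\<bar>LINT x|M. indicator A x * f x\<bar> \<le> (LINT x|M. \<bar>f x\<bar>)"
proof -
  have "\<bar>LINT x|M. indicator A x * f x\<bar> \<le> (LINT x|M. \<bar>indicator A x * f x\<bar>)"
    by (rule integral_abs_bound)
  also have "\<dots> \<le> (LINT x|M. \<bar>f x\<bar>)"
    using f by (intro integral_mono') (auto simp: indicator_def)
  finally show ?thesis .
qed

lemma abs_integral_diff_le_tail:
  fixes f :: "'a::euclidean_space \<Rightarrow> real"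
  assumes f: "integrable lborel f" and A[measurable]: "A \<in> sets borel" and sub: "cball 0 K \<subseteq> A"
  shows "\<bar>(LINT z|lborel. indicator A z * f z) - (LINT z|lborel. f z)\<bar>
    \<le> (LINT z|lborel. indicator (- cball 0 K) z * \<bar>f z\<bar>)"
proof -
  have "(LINT z|lborel. indicator A z * f z) - (LINT z|lborel. f z)
      = (LINT z|lborel. indicator A z * f z - f z)"
    using f integrable_indicator_mult[OF f, of A] by simp
  also have "\<bar>\<dots>\<bar> \<le> (LINT z|lborel. \<bar>indicator A z * f z - f z\<bar>)"
    by (rule integral_abs_bound)
  also have "\<dots> \<le> (LINT z|lborel. indicator (- cball 0 K) z * \<bar>f z\<bar>)"
    using sub f by (intro integral_mono' integrable_indicator_mult) (auto simp: indicator_def subset_eq)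
  finally show ?thesis .
qed

lemma tail_integral_tendsto_0:
  fixes f :: "'a::euclidean_space \<Rightarrow> real"
  assumes f: "integrable lborel f"
  shows "(\<lambda>k::nat. LINT z|lborel. indicator (- cball 0 (real k)) z * \<bar>f z\<bar>) \<longlonglongrightarrow> 0"
proof -
  have [measurable]: "f \<in> borel_measurable borel"
    using f by auto
  have "(\<lambda>k::nat. LINT z|lborel. indicator (- cball 0 (real k)) z * \<bar>f z\<bar>) \<longlonglongrightarrow> (LINT z::'a|lborel. 0)"
  proof (rule integral_dominated_convergence[where w="\<lambda>z. \<bar>f z\<bar>"])
    show "integrable lborel (\<lambda>z. \<bar>f z\<bar>)"
      using f by simp
    show "AE z in lborel. (\<lambda>k::nat. indicator (- cball 0 (real k)) z * \<bar>f z\<bar>) \<longlonglongrightarrow> 0"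
    proof (intro AE_I2)
      fix z :: 'a
      have "eventually (\<lambda>k::nat. norm z \<le> real k) sequentially"
        using filterlim_real_sequentially by (simp add: filterlim_at_top)
      then have "eventually (\<lambda>k::nat. indicator (- cball 0 (real k)) z * \<bar>f z\<bar> = 0) sequentially"
        by eventually_elim (simp add: indicator_def)
      then show "(\<lambda>k::nat. indicator (- cball 0 (real k)) z * \<bar>f z\<bar>) \<longlonglongrightarrow> 0"
        by (rule tendsto_eventually)
    qed
    show "AE z in lborel. norm (indicator (- cball 0 (real k)) z * \<bar>f z\<bar>) \<le> \<bar>f z\<bar>" for k :: nat
      by (auto simp: indicator_def)
  qed measurable
  then show ?thesis by simp
qed

lemma add_const_ratio_tendsto_1:
  fixes K :: real
  shows "((\<lambda>R. (R + K) / R) \<longlongrightarrow> 1) at_top"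
proof -
  have "((\<lambda>R. 1 + K / R) \<longlongrightarrow> 1 + 0) at_top"
    by (intro tendsto_intros tendsto_divide_0[OF tendsto_const] filterlim_at_top_imp_at_infinity filterlim_ident)
  moreover have "eventually (\<lambda>R. 1 + K / R = (R + K) / R) at_top"
    using eventually_gt_at_top[of 0] by eventually_elim (simp add: field_simps)
  ultimately show ?thesis
    by (simp add: Lim_transform_eventually)
qed

text \<open>The linear programming bound at finite scale. Positive definiteness is applied to the sum of
  the point masses on \<open>X\<close> minus the multiple \<open>card X / V\<close> of Lebesgue measure on the enlarged ball of
  radius \<open>R + K\<close>. The collar of width \<open>K\<close> ensures that, seen from any point of \<open>X\<close>, only the tail \<open>\<tau>\<close> of
  the integral of \<open>f\<close> is lost.\<close>

lemma separated_points_count_inequality: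
  fixes f :: "'a::euclidean_space \<Rightarrow> real" and p :: 'a
  assumes cont: "continuous_on UNIV f" and f: "integrable lborel f" and bound: "\<And>x. \<bar>f x\<bar> \<le> B"
    and cosine: "\<And>s. 0 \<le> (LINT z|lborel. f z * cos (z \<bullet> s))"
    and sine: "\<And>s. (LINT z|lborel. f z * sin (z \<bullet> s)) = 0"
    and a: "f 0 = (LINT z|lborel. f z)" "f 0 > 0"
    and neg: "\<And>x. norm x \<ge> r \<Longrightarrow> f x \<le> 0"
    and R: "R > 0" and K: "K \<ge> 0"
    and X: "finite X" "X \<subseteq> cball p R" "\<And>x y. x \<in> X \<Longrightarrow> y \<in> X \<Longrightarrow> x \<noteq> y \<Longrightarrow> r \<le> dist x y"
  defines "\<tau> \<equiv> LINT z|lborel. indicator (- cball 0 K) z * \<bar>f z\<bar>"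
    and "L \<equiv> LINT z|lborel. \<bar>f z\<bar>"
    and "V \<equiv> measure lborel (cball p (R + K))" and "V' \<equiv> measure lborel (cball p R)"
  shows "real (card X) * (f 0 - 3 * \<tau> - L * (1 - V' / V)) \<le> f 0 * V"
proof -
  define D where "D = cball p (R + K)"
  (* this constant gives the two measures M and N below the same total mass *)
  define c where "c = real (card X) / V"
  define M where "M = distr (count_space X) borel (\<lambda>x. x)"
  define N where "N = density lborel (\<lambda>y. ennreal (c * indicator D y))"
  have [measurable]: "f \<in> borel_measurable borel"
    using cont by (rule borel_measurable_continuous_onI)
  have D[measurable]: "D \<in> sets borel"
    by (simp add: D_def)
  have V: "V > 0"
    using R K by (simp add: V_def content_cball_pos)
  have c: "c \<ge> 0"
    using V by (simp add: c_def)
  have M: "finite_measure M" "sets M = sets borel"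
    unfolding M_def using X(1) by (auto intro!: finite_measure.finite_measure_distr finite_measure_count_space)
  have D_finite: "emeasure lborel D < \<infinity>"
    unfolding D_def by (intro emeasure_lborel_cball_finite)
  have N_sets: "sets N = sets borel"
    by (simp add: N_def)
  have N: "finite_measure N"
  proof (rule finite_measureI)
    have "emeasure N (space N) = (\<integral>\<^sup>+ y. ennreal c * indicator D y \<partial>lborel)"
      unfolding N_def using c by (subst emeasure_density) (auto intro!: nn_integral_cong simp: indicator_def)
    also have "\<dots> = ennreal c * emeasure lborel D"
      by (rule nn_integral_cmult_indicator) simp
    finally show "emeasure N (space N) \<noteq> \<infinity>"
      using D_finite by (simp add: ennreal_mult_eq_top_iff)
  qed
  have integral_M: "(LINT x|M. h x) = (\<Sum>x\<in>X. h x)" if "h \<in> borel_measurable borel" for h :: "'a \<Rightarrow> real"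
    unfolding M_def using X(1) that by (rule integral_distr_count_space)
  have integral_N: "(LINT x|N. h x) = c * (LINT y|lborel. indicator D y * h y)"
    if "h \<in> borel_measurable borel" for h :: "'a \<Rightarrow> real"
    unfolding N_def using c D that by (rule integral_density_indicator)
  have \<tau>: "0 \<le> \<tau>"
    unfolding \<tau>_def by (intro Bochner_Integration.integral_nonneg) simp
  define J where "J x = (LINT y|lborel. indicator D y * f (x - y))" for x
  define J' where "J' x = (LINT y|lborel. indicator D y * f (y - x))" for x
  have J_meas[measurable]: "J \<in> borel_measurable borel"
    unfolding J_def by measurable
  have J_eq: "J x = (LINT z|lborel. indicator ((\<lambda>z. x - z) -` D) z * f z)" for x
    unfolding J_def
    by (subst lborel_integral_affine[where c="-1" and t=x]) (simp_all add: indicator_def)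
  have J'_eq: "J' x = (LINT z|lborel. indicator ((\<lambda>z. x + z) -` D) z * f z)" for x
    unfolding J'_def
    by (subst lborel_integral_affine[where c=1 and t=x]) (simp_all add: indicator_def)
  have pre: "(\<lambda>z. x - z) -` D \<in> sets borel" "(\<lambda>z. x + z) -` D \<in> sets borel" for x
    using measurable_sets_borel[OF _ D, of "\<lambda>z. x - z"] measurable_sets_borel[OF _ D, of "\<lambda>z. x + z"]
    by auto
  have sub: "cball 0 K \<subseteq> (\<lambda>z. x - z) -` D" "cball 0 K \<subseteq> (\<lambda>z. x + z) -` D" if x: "x \<in> cball p R" for x
  proof -
    have "dist p (x - z) \<le> R + K" "dist p (x + z) \<le> R + K" if z: "norm z \<le> K" for z
    proof -
      have "dist p (x - z) \<le> dist p x + dist x (x - z)" "dist p (x + z) \<le> dist p x + dist x (x + z)"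
        by (rule dist_triangle)+
      moreover have "dist p x \<le> R"
        using x by simp
      ultimately show "dist p (x - z) \<le> R + K" "dist p (x + z) \<le> R + K"
        using z by (auto simp: dist_norm)
    qed
    then show "cball 0 K \<subseteq> (\<lambda>z. x - z) -` D" "cball 0 K \<subseteq> (\<lambda>z. x + z) -` D"
      by (auto simp: D_def)
  qed
  have J_close: "\<bar>J x - f 0\<bar> \<le> \<tau>" and J'_close: "\<bar>J' x - f 0\<bar> \<le> \<tau>" if "x \<in> cball p R" for x
    unfolding J_eq J'_eq a(1) \<tau>_def
    by (intro abs_integral_diff_le_tail f pre sub that)+
  have J_le: "J x \<le> L" for x
    unfolding J_eq L_def
    using abs_integral_indicator_le[OF f, of "(\<lambda>z. x - z) -` D"] pre[of x] by auto
  have L: "0 \<le> L"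
    unfolding L_def by (intro Bochner_Integration.integral_nonneg) simp
  have MM: "mutual_energy f M M \<le> real (card X) * f 0"
  proof -
    have "mutual_energy f M M = (\<Sum>x\<in>X. \<Sum>y\<in>X. f (x - y))"
      unfolding mutual_energy_def by (simp add: integral_M)
    also have "\<dots> \<le> (\<Sum>x\<in>X. \<Sum>y\<in>X. if x = y then f 0 else 0)"
      using X(3) by (intro sum_mono) (auto intro!: neg simp: dist_norm)
    also have "\<dots> = real (card X) * f 0"
      using X(1) by simp
    finally show ?thesis .
  qed
  have MN: "c * (real (card X) * (f 0 - \<tau>)) \<le> mutual_energy f M N"
  proof -
    have "(\<Sum>x\<in>X. f 0 - \<tau>) \<le> (\<Sum>x\<in>X. J x)"
      using J_close X(2) by (intro sum_mono) (force simp: abs_le_iff)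
    then have "c * (real (card X) * (f 0 - \<tau>)) \<le> c * (\<Sum>x\<in>X. J x)"
      using c by (intro mult_left_mono) simp_all
    also have "\<dots> = mutual_energy f M N"
      unfolding mutual_energy_def by (simp add: integral_N J_def[symmetric] integral_M sum_distrib_left)
    finally show ?thesis .
  qed
  have NM: "c * (real (card X) * (f 0 - \<tau>)) \<le> mutual_energy f N M"
  proof -
    have int: "integrable lborel (\<lambda>y. indicator D y * f (y - x))" for x
      using lborel_integrable_affine[OF f, of 1 "- x"] D
      by (intro integrable_indicator_mult) (simp_all add: add.commute[of "- x"])
    have "(\<Sum>x\<in>X. f 0 - \<tau>) \<le> (\<Sum>x\<in>X. J' x)"
      using J'_close X(2) by (intro sum_mono) (force simp: abs_le_iff)
    then have "c * (real (card X) * (f 0 - \<tau>)) \<le> c * (\<Sum>x\<in>X. J' x)"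
      using c by (intro mult_left_mono) simp_all
    also have "(\<Sum>x\<in>X. J' x) = (LINT y|lborel. indicator D y * (\<Sum>x\<in>X. f (y - x)))"
      unfolding J'_def sum_distrib_left by (rule Bochner_Integration.integral_sum[OF int, symmetric])
    also have "c * \<dots> = mutual_energy f N M"
      unfolding mutual_energy_def by (simp add: integral_N integral_M)
    finally show ?thesis .
  qed
  have NN: "mutual_energy f N N \<le> c\<^sup>2 * ((f 0 + \<tau>) * V + L * (V - V'))"
  proof -
    have sub': "cball p R \<subseteq> D"
      using K by (auto simp: D_def)
    have vol: "V = measure lborel D" "V' = measure lborel (cball p R)"
      by (simp_all add: V_def V'_def D_def)
    have int: "integrable lborel (indicator D :: 'a \<Rightarrow> real)"
        "integrable lborel (indicator (cball p R) :: 'a \<Rightarrow> real)"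
      using D_finite emeasure_lborel_cball_finite[of p R] by (auto simp: integrable_indicator_iff)
    (* J is within tau of f 0 on the inner ball; on the collar only the trivial bound L is available *)
    have "(LINT x|lborel. indicator D x * J x)
        \<le> (LINT x|lborel. (f 0 + \<tau>) * indicator D x + L * (indicator D x - indicator (cball p R) x))"
    proof (rule integral_mono_AE')
      show "integrable lborel (\<lambda>x. (f 0 + \<tau>) * indicator D x + L * (indicator D x - indicator (cball p R) x))"
        using int by auto
      show "AE x in lborel. indicator D x * J x
          \<le> (f 0 + \<tau>) * indicator D x + L * (indicator D x - indicator (cball p R) x)"
      proof (intro AE_I2)
        fix x
        show "indicator D x * J x \<le> (f 0 + \<tau>) * indicator D x + L * (indicator D x - indicator (cball p R) x)"
          using J_close[of x] J_le[of x] \<tau> a(2) sub' by (auto simp: indicator_def abs_le_iff)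
      qed
      show "AE x in lborel. 0 \<le> (f 0 + \<tau>) * indicator D x + L * (indicator D x - indicator (cball p R) x)"
        using \<tau> a(2) sub' L by (intro AE_I2) (auto simp: indicator_def)
    qed
    also have "\<dots> = (f 0 + \<tau>) * V + L * (V - V')"
      using int by (simp add: vol)
    finally have "c\<^sup>2 * (LINT x|lborel. indicator D x * J x) \<le> c\<^sup>2 * ((f 0 + \<tau>) * V + L * (V - V'))"
      by (rule mult_left_mono) simp
    moreover have "mutual_energy f N N = c\<^sup>2 * (LINT x|lborel. indicator D x * J x)"
    proof -
      have "mutual_energy f N N = (LINT x|N. c * J x)"
        unfolding mutual_energy_def by (simp add: integral_N J_def[symmetric])
      also have "\<dots> = c * (LINT x|lborel. indicator D x * (c * J x))"
        by (rule integral_N) simp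
      also have "\<dots> = c * (c * (LINT x|lborel. indicator D x * J x))"
        by (subst mult.left_commute) (simp only: integral_mult_right_zero)
      finally show ?thesis
        by (simp add: power2_eq_square mult.assoc)
    qed
    ultimately show ?thesis by simp
  qed
  have "0 \<le> mutual_energy f M M - mutual_energy f M N - mutual_energy f N M + mutual_energy f N N"
    by (rule mutual_energy_nonneg[OF cont f bound cosine sine M N N_sets])
  then have "0 \<le> real (card X) * f 0 - 2 * (c * (real (card X) * (f 0 - \<tau>)))
      + c\<^sup>2 * ((f 0 + \<tau>) * V + L * (V - V'))"
    using MM MN NM NN by linarith
  also have "\<dots> = real (card X) / V * (f 0 * V - real (card X) * (f 0 - 3 * \<tau> - L * (1 - V' / V)))"
    unfolding c_def using V by (simp add: field_simps power2_eq_square)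
  finally have *: "0 \<le> real (card X) / V * (f 0 * V - real (card X) * (f 0 - 3 * \<tau> - L * (1 - V' / V)))" .
  show ?thesis
  proof (cases "card X = 0")
    case True
    then show ?thesis using V a(2) by simp
  next
    case False
    then have "0 < real (card X) / V"
      using V by simp
    with * show ?thesis
      unfolding zero_le_mult_iff by linarith
  qed
qed

text \<open>First \<open>K\<close> is chosen to make the tail small, then \<open>R\<close> to make the collar negligible.\<close>

lemma separated_points_count_asymptotic:
  fixes f :: "'a::euclidean_space \<Rightarrow> real"
  assumes cont: "continuous_on UNIV f" and f: "integrable lborel f" and bound: "\<And>x. \<bar>f x\<bar> \<le> B"
    and cosine: "\<And>s. 0 \<le> (LINT z|lborel. f z * cos (z \<bullet> s))"
    and sine: "\<And>s. (LINT z|lborel. f z * sin (z \<bullet> s)) = 0"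
    and a: "f 0 = (LINT z|lborel. f z)" "f 0 > 0"
    and neg: "\<And>x. norm x \<ge> r \<Longrightarrow> f x \<le> 0"
    and \<eta>: "\<eta> > 0"
  shows "eventually (\<lambda>R. \<forall>(p::'a) X. finite X \<longrightarrow> X \<subseteq> cball p R \<longrightarrow>
      (\<forall>x\<in>X. \<forall>y\<in>X. x \<noteq> y \<longrightarrow> r \<le> dist x y) \<longrightarrow>
      real (card X) \<le> (1 + \<eta>) * measure lborel (cball p R)) at_top"
proof -
  define \<tau> where "\<tau> K = (LINT z|lborel. indicator (- cball 0 K) z * \<bar>f z\<bar>)" for K
  define L where "L = (LINT z|lborel. \<bar>f z\<bar>)"
  (* exactly what makes (1 + eta) * (f 0 - 3 * tau) exceed f 0 *)
  have "eventually (\<lambda>k::nat. \<tau> (real k) < f 0 * \<eta> / (3 * (1 + \<eta>))) sequentially"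
    unfolding \<tau>_def using a(2) \<eta> by (intro order_tendstoD(2)[OF tail_integral_tendsto_0[OF f]]) simp
  then obtain k :: nat where k: "\<tau> (real k) < f 0 * \<eta> / (3 * (1 + \<eta>))"
    by (auto simp: eventually_sequentially)
  define K where "K = real k"
  define \<theta> where "\<theta> R = ((R + K) / R) ^ DIM('a)" for R :: real
  from tendsto_power[OF add_const_ratio_tendsto_1[of K], of "DIM('a)"] have \<theta>: "(\<theta> \<longlongrightarrow> 1) at_top"
    by (simp add: \<theta>_def[abs_def])
  have "((\<lambda>R. (1 + \<eta>) * (f 0 - 3 * \<tau> K - L * (1 - 1 / \<theta> R)) - f 0 * \<theta> R)
      \<longlongrightarrow> (1 + \<eta>) * (f 0 - 3 * \<tau> K - L * (1 - 1 / 1)) - f 0 * 1) at_top"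
    by (intro tendsto_intros \<theta>) simp
  moreover have "0 < (1 + \<eta>) * (f 0 - 3 * \<tau> K - L * (1 - 1 / 1)) - f 0 * 1"
    using k \<eta> by (simp add: K_def field_simps)
  ultimately have "eventually (\<lambda>R. 0 < (1 + \<eta>) * (f 0 - 3 * \<tau> K - L * (1 - 1 / \<theta> R)) - f 0 * \<theta> R) at_top"
    by (rule order_tendstoD(1))
  then show ?thesis
    using eventually_gt_at_top[of 0]
  proof eventually_elim
    case (elim R)
    show ?case
    proof (intro allI impI)
      fix p :: 'a and X
      assume X: "finite X" "X \<subseteq> cball p R" "\<forall>x\<in>X. \<forall>y\<in>X. x \<noteq> y \<longrightarrow> r \<le> dist x y"
      let ?V = "measure lborel (cball p (R + K))" and ?V' = "measure lborel (cball p R)"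
      let ?d = "f 0 - 3 * \<tau> K - L * (1 - 1 / \<theta> R)"
      have K: "K \<ge> 0" by (simp add: K_def)
      have pos: "0 < \<theta> R" "0 < ?V'"
        using elim(2) K by (auto simp: \<theta>_def content_cball_pos)
      have V: "?V = \<theta> R * ?V'"
        using elim(2) K by (simp add: \<theta>_def content_cball power_divide)
      have "real (card X) * ?d \<le> f 0 * ?V"
        using separated_points_count_inequality[OF cont f bound cosine sine a neg elim(2) K X(1,2)] X(3) pos
        by (simp add: V \<tau>_def L_def)
      also have "\<dots> = (f 0 * \<theta> R) * ?V'"
        by (simp add: V)
      also have "\<dots> \<le> ((1 + \<eta>) * ?d) * ?V'"
        using elim(1) pos by (intro mult_right_mono) auto
      finally have "real (card X) * ?d \<le> ((1 + \<eta>) * ?V') * ?d"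
        by (simp add: mult_ac)
      moreover have "0 < ?d"
      proof -
        have "0 < f 0 * \<theta> R" using a(2) pos by simp
        then have "0 < (1 + \<eta>) * ?d" using elim(1) by linarith
        then show ?thesis using \<eta> by (simp add: zero_less_mult_iff)
      qed
      ultimately show "real (card X) \<le> (1 + \<eta>) * ?V'"
        by (simp only: mult_le_cancel_right_pos)
    qed
  qed
qed

section \<open>Sphere packings\<close>

lemma sphere_packing_centers:
  fixes P :: "(real ^ 'n) set set"
  assumes "sphere_packing P"
  obtains \<rho> C where "\<rho> > 0" "P = (\<lambda>c. cball c \<rho>) ` C"
    "\<And>x y. x \<in> C \<Longrightarrow> y \<in> C \<Longrightarrow> x \<noteq> y \<Longrightarrow> 2 * \<rho> \<le> dist x y"
proof -
  from assms obtain \<rho> where \<rho>: "\<rho> > 0" and balls: "\<And>B. B \<in> P \<Longrightarrow> \<exists>c. B = cball c \<rho>"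
    and inter: "\<And>A B. A \<in> P \<Longrightarrow> B \<in> P \<Longrightarrow> A \<noteq> B \<Longrightarrow> A \<inter> B \<subseteq> frontier A \<inter> frontier B"
    unfolding sphere_packing_def by metis
  define C where "C = {c. cball c \<rho> \<in> P}"
  have "P = (\<lambda>c. cball c \<rho>) ` C"
    unfolding C_def using balls by blast
  moreover have "2 * \<rho> \<le> dist x y" if "x \<in> C" "y \<in> C" "x \<noteq> y" for x y
  proof (rule ccontr)
    assume "\<not> 2 * \<rho> \<le> dist x y"
    then have m: "dist x (midpoint x y) < \<rho>" "dist y (midpoint x y) < \<rho>"
      by (simp_all add: dist_midpoint)
    have "cball x \<rho> \<noteq> cball y \<rho>"
      using \<open>x \<noteq> y\<close> \<rho> by (simp add: cball_eq_cball_iff)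
    then have "cball x \<rho> \<inter> cball y \<rho> \<subseteq> sphere x \<rho>"
      using inter[of "cball x \<rho>" "cball y \<rho>"] that(1,2) \<rho> unfolding C_def by (auto simp: frontier_cball)
    moreover have "midpoint x y \<in> cball x \<rho> \<inter> cball y \<rho>"
      using m by simp
    ultimately have "midpoint x y \<in> sphere x \<rho>"
      by blast
    then show False
      using m by simp
  qed
  ultimately show thesis
    using that \<rho> by blast
qed

text \<open>Only balls with centers within \<open>R + \<rho>\<close> of \<open>p\<close> meet the ball of radius \<open>R\<close>.\<close>

lemma measure_packing_le:
  fixes C :: "'a::euclidean_space set"
  assumes \<rho>: "\<rho> > 0" and fin: "finite (C \<inter> cball p (R + \<rho>))"
  shows "measure lebesgue (cball p R \<inter> \<Union>((\<lambda>c. cball c \<rho>) ` C))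
    \<le> real (card (C \<inter> cball p (R + \<rho>))) * (unit_ball_vol (DIM('a)) * \<rho> ^ DIM('a))"
proof -
  let ?X = "C \<inter> cball p (R + \<rho>)"
  have eq: "cball p R \<inter> \<Union>((\<lambda>c. cball c \<rho>) ` C) = cball p R \<inter> (\<Union>c\<in>?X. cball c \<rho>)"
  proof -
    have "c \<in> cball p (R + \<rho>)" if "z \<in> cball p R" "z \<in> cball c \<rho>" for c z
      using that dist_triangle[of p c z] by (simp add: dist_commute)
    then show ?thesis by blast
  qed
  have "measure lebesgue (cball p R \<inter> (\<Union>c\<in>?X. cball c \<rho>)) \<le> measure lebesgue (\<Union>c\<in>?X. cball c \<rho>)"
    using fin
    by (intro measure_mono_fmeasurable fmeasurable.finite_UN sets.Int fmeasurableD[OF lmeasurable_cball]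
        fmeasurableD[OF fmeasurable.finite_UN]) auto
  also have "\<dots> \<le> (\<Sum>c\<in>?X. measure lebesgue (cball c \<rho>))"
    using fin by (intro measure_UNION_le) auto
  also have "\<dots> = real (card ?X) * (unit_ball_vol (DIM('a)) * \<rho> ^ DIM('a))"
    using \<rho> by (simp add: content_cball)
  finally show ?thesis
    unfolding eq .
qed

text \<open>Dilation by \<open>r / (2 * \<rho>)\<close> turns the separation \<open>2 * \<rho>\<close> of the centers into \<open>r\<close>. Finiteness of the
  set of centers in a ball comes out of the same bound, applied to its finite subsets.\<close>

lemma center_count_scaled:
  fixes C :: "'a::euclidean_space set"
  assumes r: "r > 0" and \<rho>: "\<rho> > 0"
    and sep: "\<And>x y. x \<in> C \<Longrightarrow> y \<in> C \<Longrightarrow> x \<noteq> y \<Longrightarrow> 2 * \<rho> \<le> dist x y"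
    and count: "\<And>p X. finite X \<Longrightarrow> X \<subseteq> cball p (r / (2 * \<rho>) * S) \<Longrightarrow>
      \<forall>x\<in>X. \<forall>y\<in>X. x \<noteq> y \<longrightarrow> r \<le> dist x y \<Longrightarrow>
      real (card X) \<le> b * measure lborel (cball (p :: 'a) (r / (2 * \<rho>) * S))"
    and S: "S \<ge> 0"
  shows "finite (C \<inter> cball p S)"
    and "real (card (C \<inter> cball p S)) \<le> b * (unit_ball_vol (DIM('a)) * (r / (2 * \<rho>) * S) ^ DIM('a))"
proof -
  let ?s = "r / (2 * \<rho>)"
  have s: "?s > 0" using r \<rho> by simp
  have bound: "real (card X) \<le> b * (unit_ball_vol (DIM('a)) * (?s * S) ^ DIM('a))"
    if X: "finite X" "X \<subseteq> C \<inter> cball p S" for X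
  proof -
    let ?Y = "(\<lambda>x. ?s *\<^sub>R x) ` X"
    have dist: "dist (?s *\<^sub>R x) (?s *\<^sub>R y) = ?s * dist x y" for x y :: 'a
      using s by (metis abs_of_pos dist_norm norm_scaleR scaleR_diff_right)
    have card: "card ?Y = card X"
      using s by (intro card_image) (auto simp: inj_on_def)
    have "real (card ?Y) \<le> b * measure lborel (cball (?s *\<^sub>R p) (?s * S))"
    proof (rule count)
      show "finite ?Y" using X by simp
      show "?Y \<subseteq> cball (?s *\<^sub>R p) (?s * S)"
      proof (rule image_subsetI)
        fix x assume "x \<in> X"
        then have "dist p x \<le> S"
          using X by auto
        then have "?s * dist p x \<le> ?s * S"
          using s by (intro mult_left_mono) simp_all
        then show "?s *\<^sub>R x \<in> cball (?s *\<^sub>R p) (?s * S)"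
          by (simp only: mem_cball dist)
      qed
      show "\<forall>x\<in>?Y. \<forall>y\<in>?Y. x \<noteq> y \<longrightarrow> r \<le> dist x y"
      proof (clarify, unfold dist)
        fix x y assume "x \<in> X" "y \<in> X" "?s *\<^sub>R x \<noteq> ?s *\<^sub>R y"
        then have "?s * (2 * \<rho>) \<le> ?s * dist x y"
          using X s by (intro mult_left_mono sep) auto
        then show "r \<le> ?s * dist x y"
          using \<rho> by simp
      qed
    qed
    moreover have "measure lborel (cball (?s *\<^sub>R p) (?s * S)) = unit_ball_vol (DIM('a)) * (?s * S) ^ DIM('a)"
      using s S by (intro trans[OF _ content_cball] mult_nonneg_nonneg) simp_all
    ultimately show ?thesis
      unfolding card by simp
  qed
  show fin: "finite (C \<inter> cball p S)"
  proof (rule ccontr)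
    assume "infinite (C \<inter> cball p S)"
    obtain n :: nat where n: "b * (unit_ball_vol (DIM('a)) * (?s * S) ^ DIM('a)) < real n"
      using reals_Archimedean2 by blast
    obtain X where "X \<subseteq> C \<inter> cball p S" "finite X" "card X = n"
      using infinite_arbitrarily_large[OF \<open>infinite (C \<inter> cball p S)\<close>] by blast
    then show False
      using bound[of X] n by simp
  qed
  show "real (card (C \<inter> cball p S)) \<le> b * (unit_ball_vol (DIM('a)) * (?s * S) ^ DIM('a))"
    by (rule bound[OF fin subset_refl])
qed

lemma packing_density_le:
  fixes P :: "(real ^ 'n) set set" and r :: real
  assumes r: "r > 0" and P: "sphere_packing P"
    and count: "\<And>\<eta>. \<eta> > 0 \<Longrightarrow> eventually (\<lambda>R. \<forall>(p :: real ^ 'n) X. finite X \<longrightarrow> X \<subseteq> cball p R \<longrightarrow>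
      (\<forall>x\<in>X. \<forall>y\<in>X. x \<noteq> y \<longrightarrow> r \<le> dist x y) \<longrightarrow>
      real (card X) \<le> (1 + \<eta>) * measure lborel (cball p R)) at_top"
  shows "packing_density P \<le> ereal (unit_ball_vol (CARD('n)) * (r / 2) ^ CARD('n))"
proof (rule dense_ge)
  let ?n = "CARD('n)" and ?\<omega> = "unit_ball_vol (CARD('n))"
  let ?b = "?\<omega> * (r / 2) ^ ?n"
  obtain \<rho> C where \<rho>: "\<rho> > 0" and P_eq: "P = (\<lambda>c. cball c \<rho>) ` C"
    and sep: "\<And>x y. x \<in> C \<Longrightarrow> y \<in> C \<Longrightarrow> x \<noteq> y \<Longrightarrow> 2 * \<rho> \<le> dist x y"
    using sphere_packing_centers[OF P] by metis
  have \<omega>: "?\<omega> > 0" by simp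
  have b: "?b > 0" using r by simp
  let ?s = "r / (2 * \<rho>)"
  have s: "?s > 0" using r \<rho> by simp
  fix y' :: ereal assume y': "ereal ?b < y'"
  show "packing_density P \<le> y'"
  proof (cases y')
    case (real y)
    (* puts (1 + eta) * b midway between b and y *)
    define \<eta> where "\<eta> = (y - ?b) / (2 * ?b)"
    have y: "?b < y" using y' real by simp
    have \<eta>: "\<eta> > 0" using y b by (simp add: \<eta>_def)
    have \<eta>b: "(1 + \<eta>) * ?b < y"
    proof -
      have "(1 + (y - b) / (2 * b)) * b = (y + b) / 2" if "b > 0" for b :: real
        using that by (simp add: field_simps)
      from this[OF b] have "(1 + \<eta>) * ?b = (y + ?b) / 2"
        unfolding \<eta>_def .
      with y show ?thesis by simp
    qed
    have "((\<lambda>R. (1 + \<eta>) * ?b * ((R + \<rho>) / R) ^ ?n) \<longlongrightarrow> (1 + \<eta>) * ?b * 1 ^ ?n) at_top"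
      by (intro tendsto_intros add_const_ratio_tendsto_1)
    then have lim: "eventually (\<lambda>R. (1 + \<eta>) * ?b * ((R + \<rho>) / R) ^ ?n < y) at_top"
      using \<eta>b by (intro order_tendstoD(2)) auto
    have "filterlim (\<lambda>R. ?s * (\<rho> + R)) at_top at_top"
      by (intro filterlim_tendsto_pos_mult_at_top[OF tendsto_const s]
            filterlim_tendsto_add_at_top[OF tendsto_const] filterlim_ident)
    from eventually_compose_filterlim[OF count[OF \<eta>] this]
    have "eventually (\<lambda>R. \<forall>(p :: real ^ 'n) X. finite X \<longrightarrow> X \<subseteq> cball p (?s * (R + \<rho>)) \<longrightarrow>
      (\<forall>x\<in>X. \<forall>y\<in>X. x \<noteq> y \<longrightarrow> r \<le> dist x y) \<longrightarrow>
      real (card X) \<le> (1 + \<eta>) * measure lborel (cball p (?s * (R + \<rho>)))) at_top"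
      by (simp only: add.commute[of \<rho>])
    then have "eventually (\<lambda>R. (SUP p. ereal (measure lebesgue (cball p R \<inter> \<Union>P) / measure lebesgue (cball p R)))
        \<le> y') at_top"
      using lim eventually_gt_at_top[of 0]
    proof eventually_elim
      case (elim R)
      show ?case
      proof (rule SUP_least)
        fix p :: "real ^ 'n"
        let ?X = "C \<inter> cball p (R + \<rho>)"
        have S: "0 \<le> R + \<rho>" using elim(3) \<rho> by simp
        note X = center_count_scaled[OF r \<rho> sep elim(1)[rule_format] S, of C p, simplified]
        have "measure lebesgue (cball p R \<inter> \<Union>P) \<le> real (card ?X) * (?\<omega> * \<rho> ^ ?n)"
          unfolding P_eq using measure_packing_le[OF \<rho> X(1)] by simp
        also have "\<dots> \<le> ((1 + \<eta>) * (?\<omega> * (?s * (R + \<rho>)) ^ ?n)) * (?\<omega> * \<rho> ^ ?n)"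
          using X(2) \<rho> \<omega> by (intro mult_right_mono) auto
        also have "\<dots> = ((1 + \<eta>) * ?b * ((R + \<rho>) / R) ^ ?n) * (?\<omega> * R ^ ?n)"
        proof -
          have "(?s * (R + \<rho>)) ^ ?n * \<rho> ^ ?n = (r / 2) ^ ?n * ((R + \<rho>) / R) ^ ?n * R ^ ?n"
            using elim(3) \<rho> by (simp flip: power_mult_distrib)
          then show ?thesis by simp
        qed
        also have "\<dots> \<le> y * (?\<omega> * R ^ ?n)"
          using elim(2,3) \<omega> by (intro mult_right_mono) auto
        finally have "measure lebesgue (cball p R \<inter> \<Union>P) / (?\<omega> * R ^ ?n) \<le> y"
          using elim(3) \<omega> by (simp add: divide_le_eq)
        moreover have "measure lebesgue (cball p R) = ?\<omega> * R ^ ?n"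
          using elim(3) by (simp add: content_cball)
        ultimately show "ereal (measure lebesgue (cball p R \<inter> \<Union>P) / measure lebesgue (cball p R)) \<le> y'"
          by (simp add: real)
      qed
    qed
    then show ?thesis
      unfolding packing_density_def by (rule Limsup_bounded)
  qed (use y' in auto)
qed


section \<open>The linear programming bound\<close>

lemma
  fixes f :: "real ^ 'n \<Rightarrow> real"
  assumes f: "integrable lborel f"
  shows Re_fourier: "Re (fourier (\<lambda>x. complex_of_real (f x)) t) = (LINT x|lborel. f x * cos (x \<bullet> ((2 * pi) *\<^sub>R t)))"
    and Im_fourier: "Im (fourier (\<lambda>x. complex_of_real (f x)) t) = (LINT x|lborel. f x * sin (x \<bullet> ((2 * pi) *\<^sub>R t)))"
proof -
  let ?h = "\<lambda>x. complex_of_real (f x) * cis (x \<bullet> ((2 * pi) *\<^sub>R t))"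
  have [measurable]: "f \<in> borel_measurable borel"
    using f by auto
  have eq: "complex_of_real (f x) * exp (2 * complex_of_real pi * \<i> * complex_of_real (x \<bullet> t)) = ?h x" for x
    by (simp add: cis_conv_exp mult_ac)
  have h[measurable]: "?h \<in> borel_measurable borel"
    unfolding cis_conv_exp by measurable
  have int: "integrable lborel ?h"
    by (rule Bochner_Integration.integrable_bound[OF f]) (use h in \<open>simp_all add: norm_mult del: inner_scaleR_right\<close>)
  have "fourier (\<lambda>x. complex_of_real (f x)) t = (LINT x|lborel. ?h x)"
    unfolding fourier_def eq using h by (intro integral_completion) simp
  then show "Re (fourier (\<lambda>x. complex_of_real (f x)) t) = (LINT x|lborel. f x * cos (x \<bullet> ((2 * pi) *\<^sub>R t)))"
    "Im (fourier (\<lambda>x. complex_of_real (f x)) t) = (LINT x|lborel. f x * sin (x \<bullet> ((2 * pi) *\<^sub>R t)))"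
    using integral_Re[OF int] integral_Im[OF int] by simp_all
qed

theorem theorem3p2:
  fixes f :: "real ^ 'n \<Rightarrow> real" and r :: real
  assumes "r > 0"
    and "admissible f"
    and "complex_of_real (f 0) = fourier (\<lambda>x. complex_of_real (f x)) 0" and "f 0 > 0"
    and "\<And>x. norm x \<ge> r \<Longrightarrow> f x \<le> 0"
    and "\<And>t. fourier (\<lambda>x. complex_of_real (f x)) t \<in> \<real>\<^sub>\<ge>\<^sub>0"
  shows "\<forall>P :: (real ^ 'n) set set. sphere_packing P \<longrightarrow>
           center_density P \<le> ereal ((r / 2) ^ CARD('n))"
proof (intro allI impI)
  fix P :: "(real ^ 'n) set set" assume P: "sphere_packing P"
  have cont: "continuous_on UNIV f"
    using assms(2) by (simp add: admissible_def)
  then have meas: "f \<in> borel_measurable borel"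
    by (rule borel_measurable_continuous_onI)
  obtain \<delta> C where \<delta>: "\<delta> > 0" "C > 0"
    and decay: "\<And>x. \<bar>f x\<bar> \<le> C * (1 + norm x) powr (- real CARD('n) - \<delta>)"
    using assms(2) unfolding admissible_def by blast
  have bound: "\<bar>f x\<bar> \<le> C" for x
  proof -
    have "(1 + norm x) powr (- real CARD('n) - \<delta>) \<le> (1 + norm x) powr 0"
      using \<delta> by (intro powr_mono) auto
    also have "\<dots> = 1"
      by (simp add: add_nonneg_eq_0_iff)
    finally have "C * (1 + norm x) powr (- real CARD('n) - \<delta>) \<le> C * 1"
      using \<delta> by (intro mult_left_mono) auto
    with decay[of x] show ?thesis by simp
  qed
  (* The Bochner integral of a non-integrable function is 0, but the transform at 0 is positive. *)
  have "integrable lebesgue f"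
  proof (rule ccontr)
    assume "\<not> integrable lebesgue f"
    then have "fourier (\<lambda>x. complex_of_real (f x)) 0 = 0"
      unfolding fourier_def by (simp add: not_integrable_integral_eq)
    then show False
      using assms(3,4) by simp
  qed
  then have f: "integrable lborel f"
    using meas by (simp add: integrable_completion)
  have cosine: "0 \<le> (LINT z|lborel. f z * cos (z \<bullet> s))" for s
    using assms(6)[of "s /\<^sub>R (2 * pi)"] Re_fourier[OF f, of "s /\<^sub>R (2 * pi)"]
    by (simp add: complex_nonneg_Reals_iff)
  have sine: "(LINT z|lborel. f z * sin (z \<bullet> s)) = 0" for s
    using assms(6)[of "s /\<^sub>R (2 * pi)"] Im_fourier[OF f, of "s /\<^sub>R (2 * pi)"]
    by (simp add: complex_nonneg_Reals_iff)
  have f0: "f 0 = (LINT z|lborel. f z)"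
    using arg_cong[OF assms(3), of Re] Re_fourier[OF f, of 0] by simp
  let ?\<omega> = "pi powr (real CARD('n) / 2) / Gamma (real CARD('n) / 2 + 1)"
  have \<omega>: "unit_ball_vol (CARD('n)) = ?\<omega>" "?\<omega> > 0"
    using unit_ball_vol_pos[of "real CARD('n)"] by (simp_all add: unit_ball_vol_def)
  have "packing_density P \<le> ereal (unit_ball_vol (CARD('n)) * (r / 2) ^ CARD('n))"
    using assms(1) P
    by (rule packing_density_le)
       (rule separated_points_count_asymptotic[OF cont f bound cosine sine f0 assms(4,5)])
  then have "center_density P \<le> ereal (?\<omega> * (r / 2) ^ CARD('n)) / ereal ?\<omega>"
    unfolding center_density_def \<omega>(1) using \<omega>(2) by (intro ereal_divide_right_mono) auto
  also have "\<dots> = ereal ((r / 2) ^ CARD('n))"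
  proof -
    have "ereal (w * q) / ereal w = ereal q" if "w > 0" for w q :: real
      using that by simp
    from this[OF \<omega>(2)] show ?thesis .
  qed
  finally show "center_density P \<le> ereal ((r / 2) ^ CARD('n))" .
qed

end
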